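(* Let $f$, $\mathbf{C}$, $\mathbf{d}$, $\mathbf{P}$ and $\rho>0$ be as in the context, and assume that $f:\mathbb{R}^{M_V}\to\mathbb{R}$ is $\mu$-strongly convex and $\beta$-smooth for some $\mu,\beta>0$, and that $\mathrm{fix}(\mathbf{T}_{P,\rho})\neq\emptyset$. Let $\mathbf{x}^*$ be the (unique) primal optimal vector, let $\mathbf{z}^{(0)}\in\mathbb{R}^{M_E}$ be arbitrary, and let $(\mathbf{x}^{(k)})_{k\ge1}$ be the primal sequence generated by PDMM from $\mathbf{z}^{(0)}$. Then there exist $\epsilon\ge0$ and $\gamma\in[0,1)$ such that $$\|\mathbf{x}^{(k)}-\mathbf{x}^*\|^2\le\gamma^k\,\epsilon\qquad\text{for all integers }k\ge1.$$
   Context: $\Gamma_0(\mathbb{R}^n)$ is the set of closed, convex, proper functions $\mathbb{R}^n\to\mathbb{R}\cup\{+\infty\}$; $f^*$ is the Fenchel conjugate. A function $f$ is $\mu$-strongly convex if $f-\frac{\mu}{2}\|\cdot\|^2$ is convex, and $\beta$-smooth if it is differentiable and $\frac{\beta}{2}\|\cdot\|^2-f$ is convex. Network setting: $\mathbf{G}(V,E)$ is an undirected graph with nodes $V=\{1,\dots,N\}$ and neighbour sets $\mathcal{N}(i)=\{j:(i,j)\in E\}$. Node $i$ has $f_i\in\Gamma_0(\mathbb{R}^{M_i})$. For each edge $(i,j)\in E$ there are matrices $\mathbf{A}_{i|j}\in\mathbb{R}^{M_{ij}\times M_i}$, $\mathbf{A}_{j|i}\in\mathbb{R}^{M_{ij}\times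 M_j}$ and a vector $\mathbf{b}_{ij}=\mathbf{b}_{ji}\in\mathbb{R}^{M_{ij}}$ (with $M_{ij}=M_{ji}$). The primal problem is $\min\sum_{i}f_i(\mathbf{x}_i)$ subject to $\mathbf{A}_{i|j}\mathbf{x}_i+\mathbf{A}_{j|i}\mathbf{x}_j=\mathbf{b}_{ij}$ for all $(i,j)\in E$; a primal optimal vector is a minimiser of it. Set $M_V=\sum_iM_i$ and $f(\mathbf{x})=\sum_if_i(\mathbf{x}_i)$. Let $M_E=\sum_{i\in V}\sum_{j\in\mathcal{N}(i)}M_{ij}$ (sum over directed edges $i|j$), and index vectors in $\mathbb{R}^{M_E}$ by blocks $\boldsymbol{\lambda}_{i|j}\in\mathbb{R}^{M_{ij}}$, ordered first by $i$, then by $j$. $\mathbf{C}\in\mathbb{R}^{M_E\times M_V}$ is block diagonal with blocks $\mathbf{C}_i$, where $\mathbf{C}_i$ stacks vertically $\mathbf{A}_{i|j}$, $j\in\mathcal{N}(i)$; so $(\mathbf{C}\mathbf{x})_{i|j}=\mathbf{A}_{i|j}\mathbf{x}_i$. $\mathbf{d}\in\mathbb{R}^{M_E}$ has blocks $\mathbf{d}_{i|j}=\tfrac12\mathbf{b}_{ij}$. $\mathbf{P}$ is the symmetric permutation matrix with $(\mathbf{P}\boldsymbol{\lambda})_{i|j}=\boldsymbol{\lambda}_{j|i}$ (so $\mathbf{P}^2=\mathbf{I}$, $\mathbf{P}\mathbf{d}=\mathbf{d}$). PDMM: $\mathbf{T}_1=\mathbf{C}\,\partial f^*(\mathbf{C}^T\,\cdot)-\mathbf{d}$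 and the PDMM operator is $\mathbf{T}_{P,\rho}=\mathbf{P}\circ(2(\mathbf{I}+\rho\mathbf{T}_1)^{-1}-\mathbf{I})$, which is single valued on $\mathbb{R}^{M_E}$. PDMM generates, for $k\ge0$, $\mathbf{x}^{(k+1)}=\arg\min_{\mathbf{x}}\big(f(\mathbf{x})-\langle\mathbf{C}^T\mathbf{z}^{(k)},\mathbf{x}\rangle+\frac{\rho}{2}\|\mathbf{C}\mathbf{x}-\mathbf{d}\|^2\big)$, $\ \boldsymbol{\lambda}^{(k+1)}=\mathbf{z}^{(k)}-\rho(\mathbf{C}\mathbf{x}^{(k+1)}-\mathbf{d})$, $\ \mathbf{z}^{(k+1)}=\mathbf{P}(2\boldsymbol{\lambda}^{(k+1)}-\mathbf{z}^{(k)})$, which is the iteration $\mathbf{z}^{(k+1)}=\mathbf{T}_{P,\rho}(\mathbf{z}^{(k)})$. *)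

theory Defs
  imports "HOL-Analysis.Analysis"
begin

section \<open>Convex analysis on a subspace\<close>

text \<open>
  The notions below are relative to a carrier \<open>S\<close>, which is always a coordinate subspace standing
  for some \<open>\<real>\<^sup>n\<close>; values of functions outside \<open>S\<close> are irrelevant. Extended-real values are
  of type \<open>ereal\<close>.
\<close>

definition ereal_epigraph :: "'a set \<Rightarrow> ('a \<Rightarrow> ereal) \<Rightarrow> ('a \<times> real) set" where
  "ereal_epigraph S f = {(x, t). x \<in> S \<and> f x \<le> ereal t}"

definition Gamma0 :: "'a::euclidean_space set \<Rightarrow> ('a \<Rightarrow> ereal) set" where
  "Gamma0 S = {f. closed (ereal_epigraph S f) \<and> convex (ereal_epigraph S f) \<and>
                  (\<forall>x\<in>S. f x \<noteq> -\<infinity>) \<and> (\<exists>x\<in>S. f x \<noteq> \<infinity>)}"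

definition fenchel_conjugate :: "'a::euclidean_space set \<Rightarrow> ('a \<Rightarrow> ereal) \<Rightarrow> 'a \<Rightarrow> ereal" where
  "fenchel_conjugate S f y = (SUP x\<in>S. ereal (y \<bullet> x) - f x)"

definition subdifferential :: "'a::euclidean_space set \<Rightarrow> ('a \<Rightarrow> ereal) \<Rightarrow> 'a \<Rightarrow> 'a set" where
  "subdifferential S g y = {v\<in>S. \<forall>w\<in>S. g y + ereal (v \<bullet> (w - y)) \<le> g w}"

definition strongly_convex_on :: "'a::euclidean_space set \<Rightarrow> real \<Rightarrow> ('a \<Rightarrow> real) \<Rightarrow> bool" where
  "strongly_convex_on S \<mu> g \<longleftrightarrow> convex_on S (\<lambda>x. g x - \<mu> / 2 * (norm x)\<^sup>2)"

definition smooth_on :: "'a::euclidean_space set \<Rightarrow> real \<Rightarrow> ('a \<Rightarrow> real) \<Rightarrow> bool" where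
  "smooth_on S \<beta> g \<longleftrightarrow>
     g differentiable_on S \<and> convex_on S (\<lambda>x. \<beta> / 2 * (norm x)\<^sup>2 - g x)"


section \<open>Vectors and matrices with block-dependent dimensions\<close>

text \<open>
  The dimensions \<open>M\<^sub>i\<close> and \<open>M\<^sub>i\<^sub>j\<close> vary with the node and the edge, so they cannot be types.
  They are given by index sets: \<open>I i\<close> is a subset of a finite type with \<open>card (I i) = M\<^sub>i\<close>, and
  \<open>K i j\<close> is a subset of another finite type with \<open>card (K i j) = M\<^sub>i\<^sub>j\<close>. The space of vectors
  indexed by a set is the corresponding coordinate subspace (all other coordinates are zero), with
  the inherited inner product, norm and topology; matrices are padded with zeros likewise.
  Empty index sets, hence zero-dimensional blocks, are allowed.
\<close>

definition coord_space :: "'n set \<Rightarrow> (real ^ 'n::finite) set" where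
  "coord_space J = {u. \<forall>c. c \<notin> J \<longrightarrow> u $ c = 0}"

definition coord_matrices :: "'m set \<Rightarrow> 'n set \<Rightarrow> (real ^ 'n::finite ^ 'm::finite) set" where
  "coord_matrices R J = {B. \<forall>r c. r \<notin> R \<or> c \<notin> J \<longrightarrow> B $ r $ c = 0}"

text \<open>The spaces \<open>\<real>\<^sup>M\<close> for \<open>M = M\<^sub>V\<close> and for \<open>M = M\<^sub>E\<close> (directed edges \<open>i|j\<close>).\<close>

definition node_space :: "('v \<Rightarrow> 's set) \<Rightarrow> (real ^ ('v::finite \<times> 's::finite)) set" where
  "node_space I = coord_space {(i, s). s \<in> I i}"

definition edge_space ::
    "('v \<times> 'v) set \<Rightarrow> ('v \<Rightarrow> 'v \<Rightarrow> 'r set) \<Rightarrow> (real ^ ('v::finite \<times> 'v \<times> 'r::finite)) set" where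
  "edge_space E K = coord_space {(i, j, r). (i, j) \<in> E \<and> r \<in> K i j}"

definition node_block :: "real ^ ('v::finite \<times> 's::finite) \<Rightarrow> 'v \<Rightarrow> real ^ 's" where
  "node_block x i = (\<chi> s. x $ (i, s))"


section \<open>The network problem\<close>

definition net_objective ::
    "('v \<Rightarrow> real ^ 's \<Rightarrow> ereal) \<Rightarrow> real ^ ('v::finite \<times> 's::finite) \<Rightarrow> ereal" where
  "net_objective f x = (\<Sum>i\<in>UNIV. f i (node_block x i))"

definition primal_feasible ::
    "('v \<times> 'v) set \<Rightarrow> ('v \<Rightarrow> 's set) \<Rightarrow> ('v \<Rightarrow> 'v \<Rightarrow> real ^ 's ^ 'r) \<Rightarrow> ('v \<Rightarrow> 'v \<Rightarrow> real ^ 'r) \<Rightarrow>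
     real ^ ('v::finite \<times> 's::finite) \<Rightarrow> bool" where
  "primal_feasible E I A b x \<longleftrightarrow>
     x \<in> node_space I \<and>
     (\<forall>i j. (i, j) \<in> E \<longrightarrow> A i j *v node_block x i + A j i *v node_block x j = b i j)"

definition primal_optimal ::
    "('v \<times> 'v) set \<Rightarrow> ('v \<Rightarrow> 's set) \<Rightarrow> ('v \<Rightarrow> 'v \<Rightarrow> real ^ 's ^ 'r) \<Rightarrow> ('v \<Rightarrow> 'v \<Rightarrow> real ^ 'r) \<Rightarrow>
     ('v \<Rightarrow> real ^ 's \<Rightarrow> ereal) \<Rightarrow> real ^ ('v::finite \<times> 's::finite) \<Rightarrow> bool" where
  "primal_optimal E I A b f x \<longleftrightarrow> is_arg_min (net_objective f) (primal_feasible E I A b) x"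

definition net_C ::
    "('v \<times> 'v) set \<Rightarrow> ('v \<Rightarrow> 'v \<Rightarrow> real ^ 's ^ 'r) \<Rightarrow>
     real ^ ('v::finite \<times> 's::finite) ^ ('v \<times> 'v \<times> 'r::finite)" where
  "net_C E A = vec_lambda (\<lambda>(i, j, r). vec_lambda (\<lambda>(i', s).
     if (i, j) \<in> E \<and> i' = i then A i j $ r $ s else 0))"

definition net_d ::
    "('v \<times> 'v) set \<Rightarrow> ('v \<Rightarrow> 'v \<Rightarrow> real ^ 'r) \<Rightarrow> real ^ ('v::finite \<times> 'v \<times> 'r::finite)" where
  "net_d E b = vec_lambda (\<lambda>(i, j, r). if (i, j) \<in> E then 1 / 2 * b i j $ r else 0)"

definition net_P :: "real ^ ('v::finite \<times> 'v \<times> 'r::finite) ^ ('v \<times> 'v \<times> 'r)" where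
  "net_P = vec_lambda (\<lambda>(i, j, r). vec_lambda (\<lambda>(i', j', r').
     if i' = j \<and> j' = i \<and> r' = r then 1 else 0))"

lemma net_C_mult:
  "(net_C E A *v x) $ (i, j, r) = (if (i, j) \<in> E then (A i j *v node_block x i) $ r else 0)"
proof -
  have "(net_C E A *v x) $ (i, j, r)
      = (\<Sum>(i', s)\<in>UNIV. (if (i, j) \<in> E \<and> i' = i then A i j $ r $ s else 0) * x $ (i', s))"
    by (auto simp: matrix_vector_mult_def net_C_def intro!: sum.cong)
  also have "\<dots> = (\<Sum>i'\<in>UNIV. if i' = i then
      (\<Sum>s\<in>UNIV. (if (i, j) \<in> E then A i j $ r $ s else 0) * x $ (i', s)) else 0)"
    unfolding UNIV_Times_UNIV[symmetric] sum.cartesian_product[symmetric]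
    by (rule sum.cong) auto
  also have "\<dots> = (\<Sum>s\<in>UNIV. (if (i, j) \<in> E then A i j $ r $ s else 0) * x $ (i, s))"
    by simp
  finally show ?thesis
    by (simp add: matrix_vector_mult_def node_block_def)
qed

lemma net_P_mult: "(net_P *v l) $ (i, j, r) = l $ (j, i, r)"
proof -
  have "(net_P *v l) $ (i, j, r) = (\<Sum>q\<in>UNIV. if q = (j, i, r) then l $ q else 0)"
    by (auto simp: matrix_vector_mult_def net_P_def simp del: sum.delta sum.delta' intro!: sum.cong)
  then show ?thesis
    by simp
qed


section \<open>PDMM\<close>

text \<open>
  Operators are set valued, of type \<open>'a \<Rightarrow> 'a set\<close>; the resolvent is the inverse relation of
  \<open>I + \<rho> T\<close> on the carrier \<open>Y\<close>.
\<close>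

definition resolvent ::
    "'a::real_vector set \<Rightarrow> real \<Rightarrow> ('a \<Rightarrow> 'a set) \<Rightarrow> 'a \<Rightarrow> 'a set" where
  "resolvent Y \<rho> T z = {l\<in>Y. \<exists>t\<in>T l. l + \<rho> *\<^sub>R t = z}"

definition fix_set :: "'a set \<Rightarrow> ('a \<Rightarrow> 'a set) \<Rightarrow> 'a set" where
  "fix_set Y T = {z\<in>Y. z \<in> T z}"

definition T1_op ::
    "('v \<times> 'v) set \<Rightarrow> ('v \<Rightarrow> 's set) \<Rightarrow> ('v \<Rightarrow> 'v \<Rightarrow> real ^ 's ^ 'r) \<Rightarrow> ('v \<Rightarrow> 'v \<Rightarrow> real ^ 'r) \<Rightarrow>
     ('v \<Rightarrow> real ^ 's \<Rightarrow> ereal) \<Rightarrow>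
     real ^ ('v::finite \<times> 'v \<times> 'r::finite) \<Rightarrow> (real ^ ('v \<times> 'v \<times> 'r)) set" where
  "T1_op E I A b f l =
     (\<lambda>v::real ^ ('v \<times> 's::finite). net_C E A *v v - net_d E b) `
       subdifferential (node_space I) (fenchel_conjugate (node_space I) (net_objective f))
         (transpose (net_C E A) *v l)"

definition pdmm_op ::
    "('v \<times> 'v) set \<Rightarrow> ('v \<Rightarrow> 's set) \<Rightarrow> ('v \<Rightarrow> 'v \<Rightarrow> 'r set) \<Rightarrow> ('v \<Rightarrow> 'v \<Rightarrow> real ^ 's ^ 'r) \<Rightarrow>
     ('v \<Rightarrow> 'v \<Rightarrow> real ^ 'r) \<Rightarrow> ('v \<Rightarrow> real ^ 's::finite \<Rightarrow> ereal) \<Rightarrow> real \<Rightarrow>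
     real ^ ('v::finite \<times> 'v \<times> 'r::finite) \<Rightarrow> (real ^ ('v \<times> 'v \<times> 'r)) set" where
  "pdmm_op E I K A b f \<rho> z =
     (\<lambda>l. net_P *v (2 *\<^sub>R l - z)) ` resolvent (edge_space E K) \<rho> (T1_op E I A b f) z"

text \<open>\<open>x 0\<close> and \<open>l 0\<close> are not part of the iteration and are left unconstrained.\<close>

definition pdmm_sequence ::
    "('v \<times> 'v) set \<Rightarrow> ('v \<Rightarrow> 's set) \<Rightarrow> ('v \<Rightarrow> 'v \<Rightarrow> real ^ 's ^ 'r) \<Rightarrow> ('v \<Rightarrow> 'v \<Rightarrow> real ^ 'r) \<Rightarrow>
     ('v \<Rightarrow> real ^ 's \<Rightarrow> ereal) \<Rightarrow> real \<Rightarrow> real ^ ('v \<times> 'v \<times> 'r) \<Rightarrow>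
     (nat \<Rightarrow> real ^ ('v::finite \<times> 's::finite)) \<Rightarrow> (nat \<Rightarrow> real ^ ('v \<times> 'v \<times> 'r::finite)) \<Rightarrow>
     (nat \<Rightarrow> real ^ ('v \<times> 'v \<times> 'r)) \<Rightarrow> bool" where
  "pdmm_sequence E I A b f \<rho> z0 x l z \<longleftrightarrow>
     z 0 = z0 \<and>
     (\<forall>k. is_arg_min
            (\<lambda>y. net_objective f y - ereal ((transpose (net_C E A) *v z k) \<bullet> y)
                 + ereal (\<rho> / 2 * (norm (net_C E A *v y - net_d E b))\<^sup>2))
            (\<lambda>y. y \<in> node_space I) (x (Suc k)) \<and>
          l (Suc k) = z k - \<rho> *\<^sub>R (net_C E A *v x (Suc k) - net_d E b) \<and>
          z (Suc k) = net_P *v (2 *\<^sub>R l (Suc k) - z k))"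

end

theory Submission
  imports Defs
begin

text \<open>
  Writing \<open>e\<^sub>k\<close> for the primal error, \<open>g\<^sub>k\<close> for the difference of the gradients of \<open>f\<close> at the iterate and at
  the optimum, and \<open>y\<^sub>k\<close> for the distance vector from \<open>z\<^sub>k\<close> to a fixed point, PDMM reads
  \<open>y\<^sub>k\<^sub>+\<^sub>1 = P (y\<^sub>k - 2 \<rho> C e\<^sub>k)\<close> with \<open>C\<^sup>T y\<^sub>k = g\<^sub>k + \<rho> C\<^sup>T C e\<^sub>k\<close>, and the squared norm of \<open>y\<^sub>k\<close> decreases by
  \<open>4 \<rho> \<langle>g\<^sub>k, e\<^sub>k\<rangle>\<close>. The vector \<open>y\<^sub>k\<close> need not tend to zero: its component orthogonal to
  \<open>W = range C + P (range C)\<close> is merely permuted by \<open>P\<close>, but \<open>C\<^sup>T\<close> annihilates it, so it does not influence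
  the primal error. On \<open>W\<close> the map \<open>v \<mapsto> (C\<^sup>T v, C\<^sup>T P v)\<close> is injective, and at \<open>y\<^sub>k\<close> its two components are
  controlled by \<open>e\<^sub>k\<close> and \<open>e\<^sub>k\<^sub>+\<^sub>1\<close>, whose squared norms bound the decrease over two steps by strong
  convexity. Hence the \<open>W\<close>-component contracts every two steps.
\<close>

section \<open>Gradients relative to a subspace\<close>

text \<open>Reduces derivatives within \<open>S\<close> to one real variable: a line through a point
  of \<open>S\<close> in a direction of \<open>S\<close> never leaves \<open>S\<close>, so its
  restriction is differentiable from both sides.\<close>

lemma has_derivative_subspace_line:
  fixes q :: "'a::real_normed_vector \<Rightarrow> real"
  assumes S: "subspace S" and q: "(q has_derivative q') (at x within S)"
    and x: "x \<in> S" and h: "h \<in> S"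
  shows "((\<lambda>t. q (x + t *\<^sub>R h)) has_real_derivative q' h) (at 0)"
proof -
  have line: "((\<lambda>t. x + t *\<^sub>R h) has_derivative (\<lambda>t. t *\<^sub>R h)) (at 0)"
    by (auto intro!: derivative_eq_intros)
  have "range (\<lambda>t. x + t *\<^sub>R h) \<subseteq> S"
    using S x h by (auto intro: subspace_add subspace_scale)
  then have "(q has_derivative q') (at (x + 0 *\<^sub>R h) within range (\<lambda>t. x + t *\<^sub>R h))"
    using has_derivative_subset[OF q] by simp
  from diff_chain_within[OF line this]
  have "((\<lambda>t. q (x + t *\<^sub>R h)) has_derivative (\<lambda>t. q' (t *\<^sub>R h))) (at 0)"
    by (simp add: o_def)
  moreover have "q' (t *\<^sub>R h) = q' h * t" for t
    using linear_scale[OF has_derivative_linear[OF q]] by simp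
  ultimately show ?thesis
    by (simp add: has_field_derivative_def)
qed

lemma convex_on_subspace_above_tangent:
  fixes q :: "'a::real_normed_vector \<Rightarrow> real"
  assumes S: "subspace S" and conv: "convex_on S q"
    and q: "(q has_derivative q') (at x within S)" and x: "x \<in> S" and y: "y \<in> S"
  shows "q x + q' (y - x) \<le> q y"
proof -
  let ?\<phi> = "\<lambda>t. q (x + t *\<^sub>R (y - x))"
  have yx: "y - x \<in> S" using S x y by (simp add: subspace_diff)
  have inS: "x + t *\<^sub>R (y - x) \<in> S" for t
    using S x yx by (simp add: subspace_add subspace_scale)
  have "convex_on UNIV ?\<phi>"
  proof (rule convex_onI)
    fix t a b :: real
    assume t: "0 < t" "t < 1"
    have "x + ((1 - t) *\<^sub>R a + t *\<^sub>R b) *\<^sub>R (y - x)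
        = (1 - t) *\<^sub>R (x + a *\<^sub>R (y - x)) + t *\<^sub>R (x + b *\<^sub>R (y - x))"
      by (simp add: algebra_simps)
    then show "?\<phi> ((1 - t) *\<^sub>R a + t *\<^sub>R b) \<le> (1 - t) * ?\<phi> a + t * ?\<phi> b"
      using convex_onD[OF conv, of t "x + a *\<^sub>R (y - x)" "x + b *\<^sub>R (y - x)"] t inS
      by (metis less_eq_real_def)
  qed simp
  from convex_on_imp_above_tangent[OF this, of 0 1 "q' (y - x)"]
    has_derivative_subspace_line[OF S q x yx]
  show ?thesis by simp
qed

lemma derivative_zero_at_subspace_minimum:
  fixes q :: "'a::real_normed_vector \<Rightarrow> real"
  assumes S: "subspace S" and q: "(q has_derivative q') (at x within S)"
    and x: "x \<in> S" and h: "h \<in> S" and min: "\<And>y. y \<in> S \<Longrightarrow> q x \<le> q y"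
  shows "q' h = 0"
proof -
  have "x + t *\<^sub>R h \<in> S" for t
    using S x h by (simp add: subspace_add subspace_scale)
  then show ?thesis
    using DERIV_local_min[OF has_derivative_subspace_line[OF S q x h], of 1] min by simp
qed

text \<open>Only directions in \<open>S\<close> matter, so the Riesz vector
  \<open>adjoint F' 1\<close> of the derivative can be projected onto \<open>S\<close>; its normal
  part \<open>n\<close> pairs to zero with \<open>S\<close>.\<close>

lemma subspace_gradient_exists:
  fixes F :: "'a::euclidean_space \<Rightarrow> real"
  assumes S: "subspace S" and F: "F differentiable (at x within S)" and x: "x \<in> S"
  obtains g where "g \<in> S" "(F has_derivative (\<lambda>h. g \<bullet> h)) (at x within S)"
proof -
  obtain F' where F': "(F has_derivative F') (at x within S)"
    using F by (auto simp: differentiable_def)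
  have lin: "linear F'" using F' by (rule has_derivative_linear)
  obtain g n where g: "g \<in> span S" and n: "\<And>w. w \<in> span S \<Longrightarrow> orthogonal n w"
    and gn: "adjoint F' 1 = g + n"
    using orthogonal_subspace_decomp_exists[of S "adjoint F' 1"] by metis
  have eq: "F' h = g \<bullet> h" if "h \<in> S" for h
  proof -
    have "F' h = adjoint F' 1 \<bullet> h"
      using adjoint_works[OF lin, of h 1] by (simp add: inner_commute)
    then show ?thesis
      using n[of h] that by (simp add: gn inner_add_left orthogonal_def span_base)
  qed
  have "(F has_derivative (\<lambda>h. g \<bullet> h)) (at x within S)"
  proof -
    have "((\<lambda>y. (1 / norm (y - x)) *\<^sub>R (F y - (F x + F' (y - x)))) \<longlongrightarrow> 0) (at x within S)"
      using F' by (simp add: has_derivative_within)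
    moreover have "\<forall>\<^sub>F y in at x within S. (1 / norm (y - x)) *\<^sub>R (F y - (F x + F' (y - x)))
        = (1 / norm (y - x)) *\<^sub>R (F y - (F x + g \<bullet> (y - x)))"
      using S x by (auto simp: eventually_at_filter eq subspace_diff intro!: always_eventually)
    ultimately have "((\<lambda>y. (1 / norm (y - x)) *\<^sub>R (F y - (F x + g \<bullet> (y - x)))) \<longlongrightarrow> 0) (at x within S)"
      by (rule Lim_transform_eventually)
    then show ?thesis
      by (simp add: has_derivative_within bounded_linear_inner_right)
  qed
  moreover have "g \<in> S" using g S by (metis span_eq_iff)
  ultimately show ?thesis using that by blast
qed

section \<open>Quadratic bounds from strong convexity and smoothness\<close>

lemma has_derivative_half_norm_square:
  fixes x :: "'a::real_inner"
  shows "((\<lambda>x. c / 2 * (norm x)\<^sup>2) has_derivative (\<lambda>h. c * (x \<bullet> h))) (at x within S)"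
  unfolding power2_norm_eq_inner
  by (auto intro!: derivative_eq_intros simp: inner_commute)

text \<open>This is the tangent inequality for the convex function obtained by subtracting the
  quadratic, with the squares recombined around \<open>x\<close>.\<close>

lemma strongly_convex_on_gradient_lower:
  assumes S: "subspace S" and F: "strongly_convex_on S \<mu> F"
    and g: "(F has_derivative (\<lambda>h. g \<bullet> h)) (at x within S)" and x: "x \<in> S" and y: "y \<in> S"
  shows "F x + g \<bullet> (y - x) + \<mu> / 2 * (norm (y - x))\<^sup>2 \<le> F y"
proof -
  have "F x - \<mu> / 2 * (norm x)\<^sup>2 + (g \<bullet> (y - x) - \<mu> * (x \<bullet> (y - x))) \<le> F y - \<mu> / 2 * (norm y)\<^sup>2"
    by (rule convex_on_subspace_above_tangent[OF S F[unfolded strongly_convex_on_def] _ x y])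
      (intro has_derivative_diff g has_derivative_half_norm_square)
  then show ?thesis
    unfolding power2_norm_eq_inner by (simp add: inner_diff algebra_simps inner_commute)
qed

lemma smooth_on_gradient_upper:
  assumes S: "subspace S" and F: "smooth_on S \<beta> F"
    and g: "(F has_derivative (\<lambda>h. g \<bullet> h)) (at x within S)" and x: "x \<in> S" and y: "y \<in> S"
  shows "F y \<le> F x + g \<bullet> (y - x) + \<beta> / 2 * (norm (y - x))\<^sup>2"
proof -
  have "\<beta> / 2 * (norm x)\<^sup>2 - F x + (\<beta> * (x \<bullet> (y - x)) - g \<bullet> (y - x)) \<le> \<beta> / 2 * (norm y)\<^sup>2 - F y"
    by (rule convex_on_subspace_above_tangent[OF S F[unfolded smooth_on_def, THEN conjunct2] _ x y])
      (intro has_derivative_diff g has_derivative_half_norm_square)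
  then show ?thesis
    unfolding power2_norm_eq_inner by (simp add: inner_diff algebra_simps inner_commute)
qed

lemma strongly_convex_on_gradient_monotone:
  assumes S: "subspace S" and F: "strongly_convex_on S \<mu> F" and x: "x \<in> S" and y: "y \<in> S"
    and gx: "(F has_derivative (\<lambda>h. gx \<bullet> h)) (at x within S)"
    and gy: "(F has_derivative (\<lambda>h. gy \<bullet> h)) (at y within S)"
  shows "\<mu> * (norm (x - y))\<^sup>2 \<le> (gx - gy) \<bullet> (x - y)"
  using strongly_convex_on_gradient_lower[OF S F gx x y]
    strongly_convex_on_gradient_lower[OF S F gy y x]
  by (simp add: inner_diff algebra_simps norm_minus_commute)

text \<open>The upper bound at \<open>y\<close> is tested at the gradient step that minimises it, against the
  tangent at \<open>x\<close>.\<close>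

lemma smooth_convex_gradient_gap:
  assumes S: "subspace S" and F: "smooth_on S \<beta> F" and \<beta>: "\<beta> > 0"
    and tangent: "\<And>w. w \<in> S \<Longrightarrow> F x + gx \<bullet> (w - x) \<le> F w"
    and y: "y \<in> S" and gx: "gx \<in> S" and gy: "gy \<in> S"
    and gyd: "(F has_derivative (\<lambda>h. gy \<bullet> h)) (at y within S)"
  shows "F x + gx \<bullet> (y - x) + (norm (gx - gy))\<^sup>2 / (2 * \<beta>) \<le> F y"
proof -
  define w where "w = y + (1 / \<beta>) *\<^sub>R (gx - gy)"
  have wS: "w \<in> S"
    using S y gx gy by (simp add: w_def subspace_add subspace_scale subspace_diff)
  have "F x + gx \<bullet> (w - x) \<le> F y + gy \<bullet> (w - y) + \<beta> / 2 * (norm (w - y))\<^sup>2"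
    using tangent[OF wS] smooth_on_gradient_upper[OF S F gyd y wS] by linarith
  moreover have "gx \<bullet> (w - x) = gx \<bullet> (y - x) + gx \<bullet> (w - y)"
    by (simp add: inner_diff)
  moreover have "gx \<bullet> (w - y) - gy \<bullet> (w - y) = (norm (gx - gy))\<^sup>2 / \<beta>"
    unfolding inner_diff_left[symmetric] by (simp add: w_def power2_norm_eq_inner)
  moreover have "\<beta> / 2 * (norm (w - y))\<^sup>2 = (norm (gx - gy))\<^sup>2 / (2 * \<beta>)"
  proof -
    have "norm (w - y) = norm (gx - gy) / \<beta>"
      using \<beta> by (simp add: w_def del: scaleR_right_diff_distrib)
    then show ?thesis
      using \<beta> by (simp add: field_simps power2_eq_square)
  qed
  moreover have "(norm (gx - gy))\<^sup>2 / \<beta> = 2 * ((norm (gx - gy))\<^sup>2 / (2 * \<beta>))"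
    using \<beta> by simp
  ultimately show ?thesis by linarith
qed

text \<open>Adding the gap inequality to itself with \<open>x\<close> and \<open>y\<close> exchanged
  cancels the function values and leaves cocoercivity of the gradient; Cauchy-Schwarz turns this
  into the Lipschitz bound.\<close>

lemma smooth_strongly_convex_gradient_lipschitz:
  assumes S: "subspace S" and sc: "strongly_convex_on S \<mu> F" and \<mu>: "\<mu> > 0"
    and sm: "smooth_on S \<beta> F" and \<beta>: "\<beta> > 0"
    and x: "x \<in> S" and y: "y \<in> S" and gx: "gx \<in> S" and gy: "gy \<in> S"
    and gxd: "(F has_derivative (\<lambda>h. gx \<bullet> h)) (at x within S)"
    and gyd: "(F has_derivative (\<lambda>h. gy \<bullet> h)) (at y within S)"
  shows "norm (gx - gy) \<le> \<beta> * norm (x - y)"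
proof -
  have tangent: "F u + g \<bullet> (w - u) \<le> F w"
    if "u \<in> S" "w \<in> S" "(F has_derivative (\<lambda>h. g \<bullet> h)) (at u within S)" for u w g
  proof -
    have "0 \<le> \<mu> / 2 * (norm (w - u))\<^sup>2" using \<mu> by simp
    then show ?thesis
      using strongly_convex_on_gradient_lower[OF S sc that(3,1,2)] by linarith
  qed
  have "(norm (gx - gy))\<^sup>2 / (2 * \<beta>) + (norm (gy - gx))\<^sup>2 / (2 * \<beta>) \<le> (gx - gy) \<bullet> (x - y)"
    using smooth_convex_gradient_gap[OF S sm \<beta> tangent[OF x _ gxd] y gx gy gyd]
      smooth_convex_gradient_gap[OF S sm \<beta> tangent[OF y _ gyd] x gy gx gxd]
    by (simp add: inner_diff algebra_simps)
  then have "(norm (gx - gy))\<^sup>2 \<le> \<beta> * ((gx - gy) \<bullet> (x - y))"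
    using \<beta> by (simp add: norm_minus_commute field_simps)
  also have "\<dots> \<le> \<beta> * (norm (gx - gy) * norm (x - y))"
    using \<beta> norm_cauchy_schwarz by (simp add: mult_left_mono)
  finally have "norm (gx - gy) * norm (gx - gy) \<le> norm (gx - gy) * (\<beta> * norm (x - y))"
    by (simp add: power2_eq_square mult.left_commute)
  then show ?thesis
    using \<beta> by (cases "norm (gx - gy) = 0") (auto simp: mult_le_cancel_left)
qed

text \<open>The subgradient inequality for the conjugate is tested at the
  gradient of \<open>F\<close> at \<open>v\<close>, where the conjugate is known, so biconjugation is not needed.\<close>

lemma subdifferential_conjugate_imp_subgradient:
  assumes F: "\<And>y. y \<in> S \<Longrightarrow> H y = ereal (F y)"
    and tangent: "\<And>y. y \<in> S \<Longrightarrow> F v + w \<bullet> (y - v) \<le> F y" and w: "w \<in> S"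
    and v: "v \<in> subdifferential S (fenchel_conjugate S H) g"
    and y: "y \<in> S"
  shows "F v + g \<bullet> (y - v) \<le> F y"
proof -
  have vS: "v \<in> S" using v by (simp add: subdifferential_def)
  have "fenchel_conjugate S H w \<le> ereal (w \<bullet> v - F v)"
    unfolding fenchel_conjugate_def
    using tangent by (auto intro!: SUP_least simp: F inner_diff algebra_simps)
  moreover have "ereal (g \<bullet> y - F y) \<le> fenchel_conjugate S H g"
    unfolding fenchel_conjugate_def using y by (intro SUP_upper2[of y]) (auto simp: F)
  moreover have "fenchel_conjugate S H g + ereal (v \<bullet> (w - g)) \<le> fenchel_conjugate S H w"
    using v w by (simp add: subdifferential_def)
  ultimately have "ereal (g \<bullet> y - F y) + ereal (v \<bullet> (w - g)) \<le> ereal (w \<bullet> v - F v)"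
    by (meson add_right_mono order_trans)
  then show ?thesis
    by (simp add: inner_diff inner_commute algebra_simps)
qed

section \<open>Identifying gradients from optimality conditions\<close>

lemma has_gradient_of_minimum:
  fixes F R :: "'a::euclidean_space \<Rightarrow> real"
  assumes S: "subspace S" and F: "F differentiable (at x within S)" and x: "x \<in> S" and p: "p \<in> S"
    and R: "(R has_derivative (\<lambda>h. - (p \<bullet> h))) (at x within S)"
    and min: "\<And>y. y \<in> S \<Longrightarrow> F x + R x \<le> F y + R y"
  shows "(F has_derivative (\<lambda>h. p \<bullet> h)) (at x within S)"
proof -
  obtain g where g: "g \<in> S" "(F has_derivative (\<lambda>h. g \<bullet> h)) (at x within S)"
    using subspace_gradient_exists[OF S F x] by blast
  have "g \<bullet> h + - (p \<bullet> h) = 0" if "h \<in> S" for h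
    using derivative_zero_at_subspace_minimum[OF S has_derivative_add[OF g(2) R] x that] min by simp
  \<comment> \<open>Stationarity makes \<open>g - p\<close> orthogonal to \<open>S\<close>; as both
    vectors lie in \<open>S\<close>, it may be tested against itself.\<close>
  from this[of "g - p"] have "(g - p) \<bullet> (g - p) = 0"
    using S g p by (simp add: subspace_diff inner_diff_left)
  then show ?thesis using g by simp
qed

lemma has_gradient_of_subgradient:
  fixes F :: "'a::euclidean_space \<Rightarrow> real"
  assumes "subspace S" "F differentiable (at x within S)" "x \<in> S" "p \<in> S"
    and tangent: "\<And>y. y \<in> S \<Longrightarrow> F x + p \<bullet> (y - x) \<le> F y"
  shows "(F has_derivative (\<lambda>h. p \<bullet> h)) (at x within S)"
proof (rule has_gradient_of_minimum[where R = "\<lambda>y. - (p \<bullet> y)"])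
  show "((\<lambda>y. - (p \<bullet> y)) has_derivative (\<lambda>h. - (p \<bullet> h))) (at x within S)"
    by (auto intro!: derivative_eq_intros)
qed (use assms in \<open>auto simp: inner_diff_right algebra_simps\<close>)

text \<open>The optimality condition of the primal update: the vector under \<open>adjoint C\<close>
  is the updated multiplier, so the gradient at the new iterate is its image.\<close>

lemma has_gradient_of_proximal_step:
  fixes F :: "'a::euclidean_space \<Rightarrow> real" and C :: "'a \<Rightarrow> 'b::euclidean_space"
  assumes S: "subspace S" and F: "F differentiable (at x within S)" and x: "x \<in> S"
    and C: "linear C" and Ct: "\<And>v. adjoint C v \<in> S"
    and min: "\<And>y. y \<in> S \<Longrightarrow> F x - adjoint C z \<bullet> x + \<rho> / 2 * (norm (C x - d))\<^sup>2
                        \<le> F y - adjoint C z \<bullet> y + \<rho> / 2 * (norm (C y - d))\<^sup>2"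
  shows "(F has_derivative (\<lambda>h. adjoint C (z - \<rho> *\<^sub>R (C x - d)) \<bullet> h)) (at x within S)"
proof (rule has_gradient_of_minimum[OF S F x Ct])
  have Ct_inner: "adjoint C v \<bullet> u = v \<bullet> C u" for u v
    using adjoint_works[OF C, of u v] by (simp add: inner_commute)
  have bl: "bounded_linear C" using C by (simp add: linear_conv_bounded_linear)
  show "((\<lambda>y. - (adjoint C z \<bullet> y) + \<rho> / 2 * (norm (C y - d))\<^sup>2) has_derivative
      (\<lambda>h. - (adjoint C (z - \<rho> *\<^sub>R (C x - d)) \<bullet> h))) (at x within S)"
    unfolding power2_norm_eq_inner
    by (rule derivative_eq_intros bounded_linear_imp_has_derivative[OF bl] refl)+
      (simp only: fun_eq_iff Ct_inner, simp add: inner_diff algebra_simps inner_commute)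
  show "F x + (- (adjoint C z \<bullet> x) + \<rho> / 2 * (norm (C x - d))\<^sup>2)
      \<le> F y + (- (adjoint C z \<bullet> y) + \<rho> / 2 * (norm (C y - d))\<^sup>2)" if "y \<in> S" for y
    using min[OF that] by simp
qed

section \<open>Two-step contraction\<close>

text \<open>A factor \<open>q\<close> per two steps is \<open>sqrt q\<close> per step. The division
  by \<open>sqrt q\<close> makes the bound at index 1 equal to \<open>s 0\<close>, which covers the
  odd indices.\<close>

lemma geometric_decay_of_two_step:
  fixes s :: "nat \<Rightarrow> real"
  assumes nonneg: "\<And>k. 0 \<le> s k" and dec: "\<And>k. s (Suc k) \<le> s k"
    and q: "0 < q" "q < 1" and two: "\<And>k. s (Suc (Suc k)) \<le> q * s k"
  shows "s k \<le> sqrt q ^ k * (s 0 / sqrt q)"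
proof (induction k rule: induct_nat_012)
  case 0
  have "sqrt q * s 0 \<le> s 0"
    using q nonneg[of 0] by (intro mult_left_le_one_le) auto
  then show ?case
    using q by (simp add: field_simps)
next
  case 1
  then show ?case using q dec[of 0] by simp
next
  case (ge2 k)
  have "s (Suc (Suc k)) \<le> q * (sqrt q ^ k * (s 0 / sqrt q))"
    using two[of k] mult_left_mono[OF ge2(1), of q] q by linarith
  also have "\<dots> = (sqrt q)\<^sup>2 * (sqrt q ^ k * (s 0 / sqrt q))" using q by simp
  also have "\<dots> = sqrt q ^ Suc (Suc k) * (s 0 / sqrt q)"
    by (simp only: power2_eq_square power_Suc mult.assoc)
  finally show ?case .
qed

text \<open>Isolates the error recursion from the network; of \<open>P\<close> it keeps only that it
  is a linear isometric involution. The rate is kept positive so that an index shift can divide by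
  it.\<close>

lemma reflected_iteration_linear_rate:
  fixes C :: "'a::euclidean_space \<Rightarrow> 'b::euclidean_space" and P :: "'b \<Rightarrow> 'b"
    and e g :: "nat \<Rightarrow> 'a" and y :: "nat \<Rightarrow> 'b"
  assumes C: "linear C" and P: "linear P"
    and PP: "\<And>v. P (P v) = v" and Pinner: "\<And>u v. P u \<bullet> P v = u \<bullet> v"
    and \<rho>: "\<rho> > 0" and \<mu>: "\<mu> > 0" and \<beta>: "\<beta> > 0"
    and step: "\<And>k. y (Suc k) = P (y k - (2 * \<rho>) *\<^sub>R C (e k))"
    and stat: "\<And>k. adjoint C (y k) = g k + \<rho> *\<^sub>R adjoint C (C (e k))"
    and mono: "\<And>k. \<mu> * (norm (e k))\<^sup>2 \<le> g k \<bullet> e k"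
    and lip: "\<And>k. norm (g k) \<le> \<beta> * norm (e k)"
  shows "\<exists>\<epsilon> \<gamma>. \<epsilon> \<ge> 0 \<and> 0 < \<gamma> \<and> \<gamma> < 1 \<and> (\<forall>k. (norm (e k))\<^sup>2 \<le> \<gamma> ^ k * \<epsilon>)"
proof -
  let ?Ct = "adjoint C"
  have Ct: "linear ?Ct" using C by (rule adjoint_linear)
  have Ct_inner: "?Ct v \<bullet> u = v \<bullet> C u" for u v
    using adjoint_works[OF C, of u v] by (simp add: inner_commute)
  have P_self: "P u \<bullet> v = u \<bullet> P v" for u v
    using Pinner[of u "P v"] by (simp add: PP)
  \<comment> \<open>The smallest \<open>P\<close>-invariant subspace containing the range of
    \<open>C\<close>; \<open>P\<close> exchanges the two summands.\<close>
  define W where "W = range (\<lambda>(u, v). C u + P (C v))"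
  have linW: "linear (\<lambda>(u, v). C u + P (C v))"
    by (rule linearI) (auto simp: linear_add[OF C] linear_add[OF P] linear_scale[OF C]
        linear_scale[OF P] scaleR_add_right)
  have subW: "subspace W"
    unfolding W_def by (rule linear_subspace_image[OF linW subspace_UNIV])
  have CW: "C u \<in> W" for u
    unfolding W_def by (rule image_eqI[of _ _ "(u, 0)"]) (auto simp: linear_0[OF C] linear_0[OF P])
  have PW: "P v \<in> W" if v: "v \<in> W" for v
  proof -
    obtain u w where "v = C u + P (C w)" using v by (auto simp: W_def)
    then have "P v = C w + P (C u)" by (simp add: linear_add[OF P] PP)
    then show ?thesis unfolding W_def by (intro image_eqI[of _ _ "(w, u)"]) auto
  qed
  \<comment> \<open>Pairing \<open>v\<close> with its own representation gives
    \<open>v \<bullet> v = ?Ct v \<bullet> u + ?Ct (P v) \<bullet> w\<close>.\<close>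
  have inj: "v = 0" if vW: "v \<in> W" and zero: "?Ct v = 0" "?Ct (P v) = 0" for v
  proof -
    obtain u w where v: "v = C u + P (C w)" using vW by (auto simp: W_def)
    have "v \<bullet> v = v \<bullet> C u + P v \<bullet> C w"
      by (subst (2) v) (simp add: inner_add_right P_self)
    also have "\<dots> = 0" using zero by (simp add: Ct_inner[symmetric])
    finally show ?thesis by simp
  qed
  have linL: "linear (\<lambda>v. (?Ct v, ?Ct (P v)))"
    by (rule linearI) (auto simp: linear_add[OF Ct] linear_add[OF P] linear_scale[OF Ct]
        linear_scale[OF P])
  \<comment> \<open>In finite dimension an injective linear map on a closed subspace is bounded
    below.\<close>
  obtain c where c: "c > 0" "\<And>v. v \<in> W \<Longrightarrow> c * norm v \<le> norm (?Ct v, ?Ct (P v))"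
    using injective_imp_isometric[OF closed_subspace[OF subW] subW, of "\<lambda>v. (?Ct v, ?Ct (P v))"]
      linL inj by (force simp: linear_conv_bounded_linear zero_prod_def)

  obtain a0 n0 where a0: "a0 \<in> span W" and n0: "\<And>w. w \<in> span W \<Longrightarrow> orthogonal n0 w"
    and y0: "y 0 = a0 + n0"
    using orthogonal_subspace_decomp_exists[of W "y 0"] by metis
  have orth: "n0 \<bullet> w = 0" if "w \<in> W" for w
    using n0[of w] that by (simp add: orthogonal_def span_base)
  \<comment> \<open>The normal part of \<open>y 0\<close>, transported by \<open>P\<close> alone;
    subtracting it from \<open>y k\<close> leaves a sequence in \<open>W\<close> with the same
    recursion.\<close>
  define n where "n k = (P ^^ k) n0" for k
  have n_Suc: "n (Suc k) = P (n k)" for k by (simp add: n_def)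
  \<comment> \<open>Claiming both equations at once makes the induction step an exchange of the two,
    since \<open>P\<close> is an involution.\<close>
  have Ct_n: "?Ct (n k) = 0 \<and> ?Ct (P (n k)) = 0" for k
  proof (induction k)
    case 0
    have "?Ct n0 \<bullet> ?Ct n0 = n0 \<bullet> C (?Ct n0)"
      "?Ct (P n0) \<bullet> ?Ct (P n0) = n0 \<bullet> P (C (?Ct (P n0)))"
      by (simp_all only: Ct_inner P_self)
    then show ?case by (simp add: n_def orth CW PW)
  qed (simp add: n_Suc PP)
  define a where "a k = y k - n k" for k
  have a_Suc: "a (Suc k) = P (a k - (2 * \<rho>) *\<^sub>R C (e k))" for k
    by (simp add: a_def step n_Suc linear_diff[OF P])
  have aW: "a k \<in> W" for k
  proof (induction k)
    case 0
    have "span W = W" using subW by simp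
    then have "a0 \<in> W" using a0 by (simp only:)
    then show ?case by (simp add: a_def n_def y0)
  next
    case (Suc k)
    then show ?case
      using subW CW by (simp add: a_Suc PW subspace_diff subspace_scale)
  qed
  have Ct_a: "?Ct (a k) = g k + \<rho> *\<^sub>R ?Ct (C (e k))" for k
    using Ct_n[of k] by (simp add: a_def linear_diff[OF Ct] stat)
  have norm_P: "norm (P v) = norm v" for v
    by (simp add: norm_eq_sqrt_inner Pinner)
  \<comment> \<open>\<open>P\<close> preserves the norm, so only a square is expanded; stationarity
    then rewrites the cross term through \<open>g k \<bullet> e k\<close>.\<close>
  have decrease: "(norm (a (Suc k)))\<^sup>2 = (norm (a k))\<^sup>2 - 4 * \<rho> * (g k \<bullet> e k)" for k
  proof -
    have "(norm (a (Suc k)))\<^sup>2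
        = (norm (a k))\<^sup>2 - 4 * \<rho> * (a k \<bullet> C (e k)) + 4 * \<rho> * (\<rho> * (C (e k) \<bullet> C (e k)))"
      unfolding a_Suc norm_P power2_norm_eq_inner
      by (simp add: inner_diff inner_commute algebra_simps)
    moreover have "g k \<bullet> e k = a k \<bullet> C (e k) - \<rho> * (C (e k) \<bullet> C (e k))"
      using Ct_a[of k] by (simp add: Ct_inner[symmetric] inner_add_left)
    ultimately show ?thesis by (simp add: right_diff_distrib)
  qed
  have err: "4 * \<rho> * \<mu> * (norm (e k))\<^sup>2 \<le> (norm (a k))\<^sup>2 - (norm (a (Suc k)))\<^sup>2" for k
    using mult_left_mono[OF mono[of k], of "4 * \<rho>"] \<rho> by (simp add: decrease mult.assoc)
  have dec: "(norm (a (Suc k)))\<^sup>2 \<le> (norm (a k))\<^sup>2" for k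
  proof -
    have "0 \<le> 4 * \<rho> * \<mu> * (norm (e k))\<^sup>2" using \<rho> \<mu> by simp
    then show ?thesis using err[of k] by linarith
  qed

  obtain B1 where B1: "B1 > 0" "\<And>u. norm (?Ct (C u)) \<le> B1 * norm u"
    using linear_bounded_pos[OF linear_compose[OF C Ct]] by (auto simp: o_def)
  obtain B2 where B2: "B2 > 0" "\<And>u. norm (?Ct (P (C u))) \<le> B2 * norm u"
    using linear_bounded_pos[OF linear_compose[OF linear_compose[OF C P] Ct]] by (auto simp: o_def)
  define B where "B = \<beta> + \<rho> * B1"
  have B: "B > 0" using \<beta> \<rho> B1 by (simp add: B_def add_pos_pos)
  have bound1: "norm (?Ct (a k)) \<le> B * norm (e k)" for k
  proof -
    have "norm (?Ct (a k)) \<le> norm (g k) + \<rho> * norm (?Ct (C (e k)))"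
      unfolding Ct_a using norm_triangle_ineq[of "g k" "\<rho> *\<^sub>R ?Ct (C (e k))"] \<rho> by simp
    also have "\<dots> \<le> \<beta> * norm (e k) + \<rho> * (B1 * norm (e k))"
      using lip B1 \<rho> by (intro add_mono mult_left_mono) auto
    finally show ?thesis by (simp add: B_def algebra_simps)
  qed
  \<comment> \<open>Since \<open>P (a k) = a (Suc k) + (2 * \<rho>) *\<^sub>R P (C (e k))\<close>,
    the second component needs the next error as well; this is why the contraction takes two
    steps.\<close>
  have bound2: "norm (?Ct (P (a k))) \<le> B * norm (e (Suc k)) + 2 * \<rho> * B2 * norm (e k)" for k
  proof -
    have "?Ct (P (a k)) = ?Ct (a (Suc k)) + (2 * \<rho>) *\<^sub>R ?Ct (P (C (e k)))"
      by (simp add: a_Suc linear_diff[OF P] linear_diff[OF Ct] linear_scale[OF P] linear_scale[OF Ct])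
    then have "norm (?Ct (P (a k))) \<le> norm (?Ct (a (Suc k))) + 2 * \<rho> * norm (?Ct (P (C (e k))))"
      using norm_triangle_ineq[of "?Ct (a (Suc k))" "(2 * \<rho>) *\<^sub>R ?Ct (P (C (e k)))"] \<rho> by simp
    also have "\<dots> \<le> B * norm (e (Suc k)) + 2 * \<rho> * (B2 * norm (e k))"
      using bound1 B2 \<rho> by (intro add_mono mult_left_mono) auto
    finally show ?thesis by (simp add: mult.assoc)
  qed
  \<comment> \<open>The total coefficient of \<open>norm (e k)\<close> in the sum of both bounds; it
    also dominates the coefficient \<open>B\<close> of \<open>norm (e (Suc k))\<close>.\<close>
  define M where "M = B + 2 * \<rho> * B2"
  have M: "M > 0" using B \<rho> B2 by (simp add: M_def add_pos_pos)
  have key: "c\<^sup>2 * (norm (a k))\<^sup>2 \<le> 2 * M\<^sup>2 * ((norm (e k))\<^sup>2 + (norm (e (Suc k)))\<^sup>2)" for k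
  proof -
    have "c * norm (a k) \<le> norm (?Ct (a k)) + norm (?Ct (P (a k)))"
      using c(2)[OF aW] norm_Pair_le order_trans by blast
    also have "\<dots> \<le> M * norm (e k) + B * norm (e (Suc k))"
      using bound1[of k] bound2[of k] by (simp add: M_def algebra_simps)
    also have "\<dots> \<le> M * (norm (e k) + norm (e (Suc k)))"
    proof -
      have "B \<le> M" using \<rho> B2 by (simp add: M_def)
      then have "B * norm (e (Suc k)) \<le> M * norm (e (Suc k))" by (rule mult_right_mono) simp
      then show ?thesis by (simp add: distrib_left)
    qed
    finally have "(c * norm (a k))\<^sup>2 \<le> (M * (norm (e k) + norm (e (Suc k))))\<^sup>2"
      using c by (intro power_mono) auto
    also have "\<dots> \<le> M\<^sup>2 * (2 * ((norm (e k))\<^sup>2 + (norm (e (Suc k)))\<^sup>2))"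
      unfolding power_mult_distrib
      using zero_le_power2[of "norm (e k) - norm (e (Suc k))"]
      by (intro mult_left_mono) (auto simp: power2_sum power2_diff)
    finally show ?thesis by (simp add: power_mult_distrib algebra_simps)
  qed

  \<comment> \<open>Chosen so that \<open>key\<close>, combined with \<open>err\<close> at
    \<open>k\<close> and \<open>Suc k\<close>, gives a relative decrease \<open>\<delta>\<close>
    over two steps.\<close>
  define \<delta> where "\<delta> = 4 * \<rho> * \<mu> * c\<^sup>2 / (2 * M\<^sup>2)"
  have \<delta>: "\<delta> > 0" using \<rho> \<mu> c M by (simp add: \<delta>_def)
  \<comment> \<open>The maximum with \<open>1 / 2\<close> keeps \<open>q\<close> positive even if
    \<open>1 - \<delta>\<close> is not.\<close>
  define q where "q = max (1 / 2) (1 - \<delta>)"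
  have q: "0 < q" "q < 1" using \<delta> by (auto simp: q_def)
  have two: "(norm (a (Suc (Suc k))))\<^sup>2 \<le> q * (norm (a k))\<^sup>2" for k
  proof -
    have "2 * M\<^sup>2 * (\<delta> * (norm (a k))\<^sup>2) = 4 * \<rho> * \<mu> * (c\<^sup>2 * (norm (a k))\<^sup>2)"
      using M by (simp add: \<delta>_def)
    also have "\<dots> \<le> 4 * \<rho> * \<mu> * (2 * M\<^sup>2 * ((norm (e k))\<^sup>2 + (norm (e (Suc k)))\<^sup>2))"
      using key \<rho> \<mu> by (intro mult_left_mono) auto
    also have "\<dots> = 2 * M\<^sup>2 * (4 * \<rho> * \<mu> * (norm (e k))\<^sup>2 + 4 * \<rho> * \<mu> * (norm (e (Suc k)))\<^sup>2)"
      by (simp add: algebra_simps)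
    also have "\<dots> \<le> 2 * M\<^sup>2 * ((norm (a k))\<^sup>2 - (norm (a (Suc (Suc k))))\<^sup>2)"
      using err[of k] err[of "Suc k"] by (intro mult_left_mono) auto
    finally have "\<delta> * (norm (a k))\<^sup>2 \<le> (norm (a k))\<^sup>2 - (norm (a (Suc (Suc k))))\<^sup>2"
      using M by simp
    then have "(norm (a (Suc (Suc k))))\<^sup>2 \<le> (1 - \<delta>) * (norm (a k))\<^sup>2"
      by (simp add: algebra_simps)
    also have "\<dots> \<le> q * (norm (a k))\<^sup>2"
      by (rule mult_right_mono) (auto simp: q_def)
    finally show ?thesis .
  qed
  have rate: "(norm (a k))\<^sup>2 \<le> sqrt q ^ k * ((norm (a 0))\<^sup>2 / sqrt q)" for k
    using geometric_decay_of_two_step[of "\<lambda>k. (norm (a k))\<^sup>2" q k] dec two q by simp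
  \<comment> \<open>One step of decrease bounds the error by the current \<open>W\<close>-component,
    so its rate carries over.\<close>
  have "(norm (e k))\<^sup>2 \<le> sqrt q ^ k * ((norm (a 0))\<^sup>2 / sqrt q / (4 * \<rho> * \<mu>))" for k
  proof -
    have "4 * \<rho> * \<mu> * (norm (e k))\<^sup>2 \<le> sqrt q ^ k * ((norm (a 0))\<^sup>2 / sqrt q)"
      using err[of k] rate[of k] zero_le_power2[of "norm (a (Suc k))"] by linarith
    moreover have "0 < 4 * \<rho> * \<mu>" using \<rho> \<mu> by simp
    ultimately have "(norm (e k))\<^sup>2 \<le> sqrt q ^ k * ((norm (a 0))\<^sup>2 / sqrt q) / (4 * \<rho> * \<mu>)"
      by (simp only: pos_le_divide_eq mult.commute)
    then show ?thesis by simp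
  qed
  moreover have "0 < sqrt q" "sqrt q < 1" using q by auto
  moreover have "0 \<le> (norm (a 0))\<^sup>2 / sqrt q / (4 * \<rho> * \<mu>)" using q \<rho> \<mu> by simp
  ultimately show ?thesis by blast
qed

section \<open>PDMM on the network\<close>

lemma subspace_coord_space: "subspace (coord_space J)"
  by (auto simp: subspace_def coord_space_def)

lemma transpose_net_C_in_node_space:
  assumes "\<And>i j. (i, j) \<in> E \<Longrightarrow> A i j \<in> coord_matrices (K i j) (I i)"
  shows "transpose (net_C E A) *v v \<in> node_space I"
proof -
  have "net_C E A $ q $ (i, s) = 0" if "s \<notin> I i" for q i s
    using assms that by (cases q) (auto simp: net_C_def coord_matrices_def)
  then show ?thesis
    by (auto simp: node_space_def coord_space_def matrix_vector_mult_def transpose_def)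
qed

lemma net_P_involution: "net_P *v (net_P *v v) = v"
  by (auto simp: vec_eq_iff net_P_mult)

lemma net_P_inner: "(net_P *v u) \<bullet> (net_P *v v) = u \<bullet> v"
proof -
  have "(net_P *v u) \<bullet> (net_P *v v) = (\<Sum>(i, j, r)\<in>UNIV. u $ (j, i, r) * v $ (j, i, r))"
    by (auto simp: inner_vec_def net_P_mult intro!: sum.cong)
  also have "\<dots> = (\<Sum>q\<in>UNIV. u $ q * v $ q)"
    by (rule sum.reindex_bij_witness[of _ "\<lambda>(i, j, r). (j, i, r)" "\<lambda>(i, j, r). (j, i, r)"]) auto
  finally show ?thesis by (simp add: inner_vec_def)
qed

text \<open>Each endpoint carries half of \<open>b i j\<close>, so the edge equation says that the
  residual blocks of the two directions add to zero; off \<open>E\<close> both blocks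
  vanish.\<close>

lemma primal_feasible_iff_antisymmetric:
  assumes E: "sym E" and b: "\<And>i j. (i, j) \<in> E \<Longrightarrow> b i j = b j i"
  shows "primal_feasible E I A b y \<longleftrightarrow> y \<in> node_space I \<and>
    net_P *v (net_C E A *v y - net_d E b) = - (net_C E A *v y - net_d E b)"
proof -
  have "(net_P *v (net_C E A *v y - net_d E b)) $ (i, j, r) = - (net_C E A *v y - net_d E b) $ (i, j, r)
      \<longleftrightarrow> ((i, j) \<in> E \<longrightarrow> (A i j *v node_block y i + A j i *v node_block y j) $ r = b i j $ r)" for i j r
    using symD[OF E, of i j] symD[OF E, of j i] b[of i j]
    by (auto simp: net_P_mult net_C_mult net_d_def)
  then show ?thesis
    by (auto simp: primal_feasible_def vec_eq_iff)
qed

theorem mainTheorem3: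
  fixes E :: "('v::finite \<times> 'v) set"
    and I :: "'v \<Rightarrow> 's::finite set"
    and K :: "'v \<Rightarrow> 'v \<Rightarrow> 'r::finite set"
    and A :: "'v \<Rightarrow> 'v \<Rightarrow> real ^ 's ^ 'r"
    and b :: "'v \<Rightarrow> 'v \<Rightarrow> real ^ 'r"
    and f :: "'v \<Rightarrow> real ^ 's \<Rightarrow> ereal"
    and F :: "real ^ ('v \<times> 's) \<Rightarrow> real"
    and \<rho> \<mu> \<beta> :: real
    and xopt :: "real ^ ('v \<times> 's)"
    and z0 :: "real ^ ('v \<times> 'v \<times> 'r)"
    and x :: "nat \<Rightarrow> real ^ ('v \<times> 's)"
    and l z :: "nat \<Rightarrow> real ^ ('v \<times> 'v \<times> 'r)"
  assumes "sym E"
    and "\<And>i j. (i, j) \<in> E \<Longrightarrow> K i j = K j i"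
    and "\<And>i. f i \<in> Gamma0 (coord_space (I i))"
    and "\<And>i j. (i, j) \<in> E \<Longrightarrow> A i j \<in> coord_matrices (K i j) (I i)"
    and "\<And>i j. (i, j) \<in> E \<Longrightarrow> b i j \<in> coord_space (K i j)"
    and "\<And>i j. (i, j) \<in> E \<Longrightarrow> b i j = b j i"
    and "\<rho> > 0"
    and "\<And>y. y \<in> node_space I \<Longrightarrow> net_objective f y = ereal (F y)"
    and "\<mu> > 0" and "strongly_convex_on (node_space I) \<mu> F"
    and "\<beta> > 0" and "smooth_on (node_space I) \<beta> F"
    and "fix_set (edge_space E K) (pdmm_op E I K A b f \<rho>) \<noteq> {}"
    and "primal_optimal E I A b f xopt"
    and "z0 \<in> edge_space E K"
    and "pdmm_sequence E I A b f \<rho> z0 x l z"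
  shows "\<exists>\<epsilon> \<gamma>. \<epsilon> \<ge> 0 \<and> 0 \<le> \<gamma> \<and> \<gamma> < 1 \<and>
           (\<forall>k::nat. k \<ge> 1 \<longrightarrow> (norm (x k - xopt))\<^sup>2 \<le> \<gamma> ^ k * \<epsilon>)"
proof -
  define S where "S = node_space I"
  define C where "C = (\<lambda>y. net_C E A *v y)"
  define P where "P = (\<lambda>v::real ^ ('v \<times> 'v \<times> 'r). net_P *v v)"
  define d where "d = net_d E b"
  have S: "subspace S" by (simp add: S_def node_space_def subspace_coord_space)
  have C: "linear C" by (simp add: C_def)
  have P: "linear P" by (simp add: P_def)
  have Ct_eq: "adjoint C = (\<lambda>v. transpose (net_C E A) *v v)"
    unfolding C_def by (rule adjoint_matrix)
  have CtS: "adjoint C v \<in> S" for v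
    unfolding Ct_eq S_def by (rule transpose_net_C_in_node_space[OF assms(4)])
  have Ct: "linear (adjoint C)" using C by (rule adjoint_linear)
  have PP: "P (P v) = v" for v by (simp add: P_def net_P_involution)
  have Pinner: "P u \<bullet> P v = u \<bullet> v" for u v by (simp add: P_def net_P_inner)
  have F_eq: "net_objective f y = ereal (F y)" if "y \<in> S" for y
    using assms(8) that by (simp add: S_def)
  have sc: "strongly_convex_on S \<mu> F" and sm: "smooth_on S \<beta> F"
    using assms by (simp_all add: S_def)
  have F_diff: "F differentiable (at y within S)" if "y \<in> S" for y
    using sm that by (simp add: smooth_on_def differentiable_on_def)
  have feasible: "primal_feasible E I A b y \<longleftrightarrow> y \<in> S \<and> P (C y - d) = - (C y - d)" for y
    unfolding S_def P_def C_def d_def by (rule primal_feasible_iff_antisymmetric[OF assms(1,6)])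

  \<comment> \<open>The fixed point and primal optimality\<close>
  obtain zs ls v where v: "v \<in> subdifferential S (fenchel_conjugate S (net_objective f)) (adjoint C ls)"
    and zs: "ls + \<rho> *\<^sub>R (C v - d) = zs" and fixP: "zs = P (2 *\<^sub>R ls - zs)"
    using assms(13)
    by (auto simp: fix_set_def pdmm_op_def resolvent_def T1_op_def S_def C_def P_def d_def
        adjoint_matrix)
  have vS: "v \<in> S" using v by (simp add: subdifferential_def)
  \<comment> \<open>Inverts the conjugate subdifferential: the gradient of \<open>F\<close> at
    \<open>v\<close> is \<open>adjoint C ls\<close>.\<close>
  have v_grad: "(F has_derivative (\<lambda>h. adjoint C ls \<bullet> h)) (at v within S)"
  proof (rule has_gradient_of_subgradient[OF S F_diff[OF vS] vS CtS])
    fix y assume y: "y \<in> S"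
    obtain w where w: "w \<in> S" "(F has_derivative (\<lambda>h. w \<bullet> h)) (at v within S)"
      using subspace_gradient_exists[OF S F_diff[OF vS] vS] by blast
    have tangent: "F v + w \<bullet> (y - v) \<le> F y" if "y \<in> S" for y
    proof -
      have "0 \<le> \<mu> / 2 * (norm (y - v))\<^sup>2" using \<open>\<mu> > 0\<close> by simp
      then show ?thesis
        using strongly_convex_on_gradient_lower[OF S sc w(2) vS that] by linarith
    qed
    show "F v + adjoint C ls \<bullet> (y - v) \<le> F y"
      by (rule subdifferential_conjugate_imp_subgradient[OF F_eq tangent w(1) v y])
  qed

  have fixP': "P ls + \<rho> *\<^sub>R P (C v - d) = ls - \<rho> *\<^sub>R (C v - d)"
  proof -
    have "P zs = 2 *\<^sub>R ls - zs" by (subst fixP) (rule PP)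
    then show ?thesis
      by (simp add: zs[symmetric] linear_add[OF P] linear_scale[OF P] scaleR_2)
  qed
  \<comment> \<open>Applying \<open>P\<close> to \<open>fixP'\<close> gives a companion equation.
    Their sum shows that \<open>ls\<close> is \<open>P\<close>-symmetric, and then
    \<open>fixP'\<close> that the residual of \<open>v\<close> is antisymmetric, i.e.
    \<open>v\<close> is feasible.\<close>
  have "P ls - \<rho> *\<^sub>R P (C v - d) = ls + \<rho> *\<^sub>R (C v - d)"
    using arg_cong[OF fixP', of P]
    by (simp add: linear_add[OF P] linear_diff[OF P] linear_scale[OF P] PP)
  with fixP' have "(P ls + \<rho> *\<^sub>R P (C v - d)) + (P ls - \<rho> *\<^sub>R P (C v - d))
      = (ls - \<rho> *\<^sub>R (C v - d)) + (ls + \<rho> *\<^sub>R (C v - d))"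
    by (simp only:)
  then have "(2::real) *\<^sub>R P ls = (2::real) *\<^sub>R ls"
    unfolding scaleR_2 by simp
  then have Pls: "P ls = ls" by simp
  have v_feas: "P (C v - d) = - (C v - d)"
  proof -
    have "\<rho> *\<^sub>R P (C v - d) = \<rho> *\<^sub>R (- (C v - d))" using fixP' by (simp add: Pls algebra_simps)
    then show ?thesis using \<open>\<rho> > 0\<close> by (simp only: scaleR_cancel_left) simp
  qed
  have opt: "xopt \<in> S" "P (C xopt - d) = - (C xopt - d)"
    using assms(14) feasible by (auto simp: primal_optimal_def is_arg_min_def)
  have "F xopt \<le> F v"
    using assms(14) feasible[of v] vS v_feas opt
    by (auto simp: primal_optimal_def is_arg_min_def F_eq not_less)
  \<comment> \<open>A symmetric multiplier is orthogonal to the antisymmetric difference of two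
    feasible residuals, so the linear term of the lower bound at \<open>v\<close> vanishes and
    strong convexity forces \<open>v = xopt\<close>.\<close>
  moreover have "adjoint C ls \<bullet> (xopt - v) = 0"
  proof -
    let ?w = "(C xopt - d) - (C v - d)"
    have "ls \<bullet> ?w = P ls \<bullet> P ?w" by (simp only: Pinner)
    also have "\<dots> = - (ls \<bullet> ?w)"
      by (simp only: Pls linear_diff[OF P, of "C xopt - d"] opt v_feas) (simp add: inner_diff)
    finally have "ls \<bullet> C (xopt - v) = 0" by (simp add: linear_diff[OF C])
    then show ?thesis
      using adjoint_works[OF C, of "xopt - v" ls] by (simp add: inner_commute)
  qed
  ultimately have "\<mu> / 2 * (norm (xopt - v))\<^sup>2 \<le> 0"
    using strongly_convex_on_gradient_lower[OF S sc v_grad vS opt(1)] by linarith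
  then have v_eq: "v = xopt" using \<open>\<mu> > 0\<close> by (simp add: mult_le_0_iff)

  \<comment> \<open>Optimality conditions of the iterates\<close>
  have seq: "is_arg_min (\<lambda>y. net_objective f y - ereal (adjoint C (z k) \<bullet> y)
        + ereal (\<rho> / 2 * (norm (C y - d))\<^sup>2)) (\<lambda>y. y \<in> S) (x (Suc k))"
    and l_Suc: "l (Suc k) = z k - \<rho> *\<^sub>R (C (x (Suc k)) - d)"
    and z_Suc: "z (Suc k) = P (2 *\<^sub>R l (Suc k) - z k)" for k
    using assms(16) by (simp_all add: pdmm_sequence_def adjoint_matrix C_def P_def d_def S_def)
  have xS: "x (Suc k) \<in> S" for k using seq[of k] by (simp add: is_arg_min_def)
  have x_grad: "(F has_derivative (\<lambda>h. adjoint C (l (Suc k)) \<bullet> h)) (at (x (Suc k)) within S)" for k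
    unfolding l_Suc
  proof (rule has_gradient_of_proximal_step[OF S F_diff[OF xS] xS C CtS])
    fix y assume "y \<in> S"
    then show "F (x (Suc k)) - adjoint C (z k) \<bullet> x (Suc k) + \<rho> / 2 * (norm (C (x (Suc k)) - d))\<^sup>2
        \<le> F y - adjoint C (z k) \<bullet> y + \<rho> / 2 * (norm (C y - d))\<^sup>2"
      using seq[of k] by (auto simp: is_arg_min_def F_eq not_less)
  qed

  \<comment> \<open>The error at index \<open>k\<close> is taken at \<open>x (Suc k)\<close>, the
    iterate computed from \<open>z k\<close>, because \<open>x 0\<close> is unconstrained.\<close>
  have "\<exists>\<epsilon> \<gamma>. \<epsilon> \<ge> 0 \<and> 0 < \<gamma> \<and> \<gamma> < 1 \<and> (\<forall>k. (norm (x (Suc k) - xopt))\<^sup>2 \<le> \<gamma> ^ k * \<epsilon>)"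
  proof (rule reflected_iteration_linear_rate[where y = "\<lambda>k. z k - zs"
        and g = "\<lambda>k. adjoint C (l (Suc k)) - adjoint C ls",
        OF C P PP Pinner \<open>\<rho> > 0\<close> \<open>\<mu> > 0\<close> \<open>\<beta> > 0\<close>])
    fix k
    \<comment> \<open>Subtracting the fixed-point relations from the update eliminates
      \<open>d\<close> and leaves a recursion in differences.\<close>
    have ls_eq: "ls = zs - \<rho> *\<^sub>R (C xopt - d)" using zs by (auto simp: v_eq)
    have "z (Suc k) - zs = P ((2 *\<^sub>R l (Suc k) - z k) - (2 *\<^sub>R ls - zs))"
      by (simp only: linear_diff[OF P, of "2 *\<^sub>R l (Suc k) - z k"] z_Suc fixP[symmetric])
    also have "(2 *\<^sub>R l (Suc k) - z k) - (2 *\<^sub>R ls - zs)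
        = z k - zs - (2 * \<rho>) *\<^sub>R C (x (Suc k) - xopt)"
      by (simp add: l_Suc ls_eq linear_diff[OF C] scaleR_2 algebra_simps)
    finally show "z (Suc k) - zs = P (z k - zs - (2 * \<rho>) *\<^sub>R C (x (Suc k) - xopt))" .
    have "z k - zs = (l (Suc k) - ls) + \<rho> *\<^sub>R C (x (Suc k) - xopt)"
      by (simp add: l_Suc ls_eq linear_diff[OF C] algebra_simps)
    then show "adjoint C (z k - zs) = adjoint C (l (Suc k)) - adjoint C ls
        + \<rho> *\<^sub>R adjoint C (C (x (Suc k) - xopt))"
      by (simp add: linear_add[OF Ct] linear_diff[OF Ct] linear_scale[OF Ct])
    show "\<mu> * (norm (x (Suc k) - xopt))\<^sup>2
        \<le> (adjoint C (l (Suc k)) - adjoint C ls) \<bullet> (x (Suc k) - xopt)"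
      by (rule strongly_convex_on_gradient_monotone[OF S sc xS opt(1) x_grad v_grad[unfolded v_eq]])
    show "norm (adjoint C (l (Suc k)) - adjoint C ls) \<le> \<beta> * norm (x (Suc k) - xopt)"
      by (rule smooth_strongly_convex_gradient_lipschitz[OF S sc \<open>\<mu> > 0\<close> sm \<open>\<beta> > 0\<close> xS opt(1) CtS CtS
            x_grad v_grad[unfolded v_eq]])
  qed
  then obtain \<epsilon> \<gamma> where r: "\<epsilon> \<ge> 0" "0 < \<gamma>" "\<gamma> < 1"
    and rate: "\<And>k. (norm (x (Suc k) - xopt))\<^sup>2 \<le> \<gamma> ^ k * \<epsilon>" by blast
  \<comment> \<open>Returning to index \<open>k\<close> from \<open>k - 1\<close> costs one factor
    \<open>\<gamma>\<close>, absorbed in the constant.\<close>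
  have "(norm (x k - xopt))\<^sup>2 \<le> \<gamma> ^ k * (\<epsilon> / \<gamma>)" if "k \<ge> 1" for k
    using rate[of "k - 1"] that r by (cases k) auto
  then show ?thesis
    using r by (intro exI[of _ "\<epsilon> / \<gamma>"] exI[of _ \<gamma>]) auto
qed

end
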